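(* For any two matrices $A^\star, B^\star \in \mathbb{R}^{n\times n}$, $$\mu(A^\star)\,\xi(B^\star) < 1 \quad \Longrightarrow \quad \Omega(A^\star) \cap T(B^\star) = \{0\}.$$
   Context: All matrices are real $n \times n$. $\|\cdot\|$ denotes the spectral norm (largest singular value) and $\|\cdot\|_\infty$ denotes the largest absolute value of an entry. For a matrix $M$ of rank $k$ with (compact) singular value decomposition $M = U\Sigma V^T$, $U,V \in \mathbb{R}^{n\times k}$, define the subspace of $\mathbb{R}^{n\times n}$ $$T(M) = \{U X^T + Y V^T : X, Y \in \mathbb{R}^{n \times k}\}.$$ Define the subspace $$\Omega(M) = \{N \in \mathbb{R}^{n\times n} : \mathrm{support}(N) \subseteq \mathrm{support}(M)\},$$ where $\mathrm{support}(M)$ is the set of index pairs $(i,j)$ with $M_{i,j}\neq 0$. Define $$\xi(M) = \max_{N \in T(M),\ \|N\| \leq 1} \|N\|_\infty, \qquad \mu(M) = \max_{N \in \Omega(M),\ \|N\|_\infty \leq 1} \|N\|.$$ *)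

theory Defs
  imports "HOL-Analysis.Analysis"
begin

text \<open>
  The singular values of \<open>A\<close> are the square roots of the eigenvalues of \<open>A\<^sup>T A\<close>.
  For a square matrix they form a finite nonempty set.
\<close>

definition singular_values :: "real^'n^'n \<Rightarrow> real set" where
  "singular_values A =
     {s. s \<ge> 0 \<and> (\<exists>v. v \<noteq> 0 \<and> (transpose A ** A) *v v = s\<^sup>2 *\<^sub>R v)}"

definition spectral_norm :: "real^'n^'n \<Rightarrow> real" where
  "spectral_norm A = Max (singular_values A)"

definition max_entry_norm :: "real^'n^'n \<Rightarrow> real" where
  "max_entry_norm A = Max {\<bar>A $ i $ j\<bar> | i j. True}"

text \<open>
  An \<open>n \<times> k\<close> matrix, where \<open>k\<close> is the rank of some matrix (and may be \<open>0\<close>, so that it cannot be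
  the cardinality of an index type), is represented by its columns \<open>U 0, \<dots>, U (k - 1)\<close>;
  the values of \<open>U\<close> at indices \<open>\<ge> k\<close> are irrelevant. The following is the product
  \<open>U X\<^sup>T\<close> of two such matrices.
\<close>

definition mult_transpose :: "nat \<Rightarrow> (nat \<Rightarrow> real^'n) \<Rightarrow> (nat \<Rightarrow> real^'n) \<Rightarrow> real^'n^'n" where
  "mult_transpose k U X = (\<chi> i j. \<Sum>l<k. U l $ i * X l $ j)"

definition orthonormal_columns :: "nat \<Rightarrow> (nat \<Rightarrow> real^'n) \<Rightarrow> bool" where
  "orthonormal_columns k U \<longleftrightarrow>
     (\<forall>i<k. \<forall>j<k. U i \<bullet> U j = (if i = j then 1 else 0))"

text \<open>
  \<open>M = U \<Sigma> V\<^sup>T\<close>, where \<open>\<Sigma>\<close> is the diagonal matrix with the entries \<open>\<sigma> 0, \<dots>, \<sigma> (k - 1)\<close> and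
  \<open>k\<close> is the rank of \<open>M\<close>. The diagonal entries are not required to be sorted.
\<close>

definition compact_svd ::
  "real^'n^'n \<Rightarrow> (nat \<Rightarrow> real^'n) \<Rightarrow> (nat \<Rightarrow> real) \<Rightarrow> (nat \<Rightarrow> real^'n) \<Rightarrow> bool" where
  "compact_svd M U \<sigma> V \<longleftrightarrow>
     orthonormal_columns (rank M) U \<and> orthonormal_columns (rank M) V \<and>
     (\<forall>l<rank M. \<sigma> l > 0) \<and>
     M = mult_transpose (rank M) (\<lambda>l. \<sigma> l *\<^sub>R U l) V"

text \<open>
  A compact singular value decomposition is not unique, but the space
  \<open>{U X\<^sup>T + Y V\<^sup>T | X Y}\<close> depends only on the column spaces of \<open>U\<close> and \<open>V\<close>, which are those of
  \<open>M\<close> and \<open>M\<^sup>T\<close>. Every decomposition therefore contributes the same matrices below.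
\<close>

definition tangent_space :: "real^'n^'n \<Rightarrow> (real^'n^'n) set" where
  "tangent_space M =
     {mult_transpose (rank M) U X + mult_transpose (rank M) Y V | U \<sigma> V X Y. compact_svd M U \<sigma> V}"

definition matrix_support :: "real^'n^'n \<Rightarrow> ('n \<times> 'n) set" where
  "matrix_support M = {(i, j). M $ i $ j \<noteq> 0}"

definition support_space :: "real^'n^'n \<Rightarrow> (real^'n^'n) set" where
  "support_space M = {N. matrix_support N \<subseteq> matrix_support M}"

text \<open>
  The two suprema are maxima: continuous functions are maximised over nonempty compact sets.
\<close>

definition xi :: "real^'n^'n \<Rightarrow> real" where
  "xi M = (SUP N \<in> {N \<in> tangent_space M. spectral_norm N \<le> 1}. max_entry_norm N)"

definition mu :: "real^'n^'n \<Rightarrow> real" where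
  "mu M = (SUP N \<in> {N \<in> support_space M. max_entry_norm N \<le> 1}. spectral_norm N)"

end

theory Submission
  imports Defs
begin

text \<open>
  The spectral norm is the operator norm, which yields the bounds that make the suprema defining
  \<open>\<mu>\<close> and \<open>\<xi>\<close> genuine upper bounds. Rescaling a nonzero \<open>N\<close> in the intersection to spectral norm
  \<open>1\<close>, respectively to maximal entry \<open>1\<close>, gives \<open>\<parallel>N\<parallel>\<^sub>\<infinity> / \<parallel>N\<parallel> \<le> \<xi>(B)\<close> and
  \<open>\<parallel>N\<parallel> / \<parallel>N\<parallel>\<^sub>\<infinity> \<le> \<mu>(A)\<close>, whose product contradicts \<open>\<mu>(A) \<xi>(B) < 1\<close>. That \<open>0\<close> lies in the
  tangent space needs the existence of a singular value decomposition, obtained by repeatedly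
  splitting off a right singular vector for the largest singular value.
\<close>

text \<open>As a simp rule it turns \<open>transpose A *v x\<close> into \<open>x v* A\<close>,
  which hides the form in which the adjoint and singular vector equations are used.\<close>

declare transpose_matrix_vector [simp del]

section \<open>Operator norm and its maximising vectors\<close>

abbreviation opnorm :: "real^'n^'m \<Rightarrow> real" where
  "opnorm A \<equiv> onorm ((*v) A)"

lemma norm_matrix_vector_le: "norm (A *v x) \<le> opnorm A * norm x" for A :: "real^'n^'m"
  by (rule onorm) (rule matrix_vector_mul_bounded_linear)

lemma opnorm_nonneg: "0 \<le> opnorm A" for A :: "real^'n^'m"
  by (rule onorm_pos_le) (rule matrix_vector_mul_bounded_linear)

lemma inner_transpose: "(transpose A *v x) \<bullet> y = x \<bullet> (A *v y)" for A :: "real^'n^'m"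
  by (simp add: dot_lmul_matrix transpose_matrix_vector)

text \<open>Cauchy-Schwarz applied to |z|^2 = y . (A z) for z = A^T y; one factor |z| is then
  cancelled.\<close>

lemma norm_transpose_vector_le: "norm (transpose A *v y) \<le> opnorm A * norm y"
  for A :: "real^'n^'m"
proof -
  let ?z = "transpose A *v y"
  have "norm ?z * norm ?z = y \<bullet> (A *v ?z)"
    using inner_transpose[of A y ?z] by (simp add: dot_square_norm power2_eq_square)
  also have "\<dots> \<le> norm y * norm (A *v ?z)"
    by (rule norm_cauchy_schwarz)
  also have "\<dots> \<le> norm y * (opnorm A * norm ?z)"
    by (intro mult_left_mono norm_matrix_vector_le) simp
  finally have "norm ?z * norm ?z \<le> (opnorm A * norm y) * norm ?z"
    by (simp add: mult_ac)
  then show ?thesis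
    by (cases "norm ?z = 0") (auto simp: opnorm_nonneg)
qed

text \<open>The unit sphere is compact, and by homogeneity a maximiser on it bounds the ratio |A x|
  / |x| everywhere.\<close>

lemma opnorm_attained:
  fixes A :: "real^'n^'m"
  obtains v where "norm v = 1" "norm (A *v v) = opnorm A"
proof -
  have "sphere (0::real^'n) 1 \<noteq> {}"
    using vector_choose_size[of 1] by (metis empty_iff mem_sphere_0 zero_le_one)
  moreover have "continuous_on (sphere 0 1) (\<lambda>x. norm (A *v x))"
    by (intro continuous_intros)
  ultimately obtain v where v: "v \<in> sphere 0 1"
    and max: "\<And>x. x \<in> sphere 0 1 \<Longrightarrow> norm (A *v x) \<le> norm (A *v v)"
    using continuous_attains_sup[OF compact_sphere] by metis
  have "norm (A *v x) \<le> norm (A *v v) * norm x" for x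
  proof (cases "x = 0")
    case False
    then have "norm (A *v (inverse (norm x) *\<^sub>R x)) \<le> norm (A *v v)"
      by (intro max) simp
    with False show ?thesis
      by (simp add: matrix_vector_mult_scaleR field_simps)
  qed simp
  then have "opnorm A \<le> norm (A *v v)"
    by (rule onorm_le)
  moreover have "norm (A *v v) \<le> opnorm A"
    using norm_matrix_vector_le[of A v] v by simp
  ultimately show thesis
    using that v by simp
qed

text \<open>This is equality in Cauchy-Schwarz: w = A^T A v has length at most s^2, yet w . v = s^2.
  Expanding |w - s^2 v|^2 therefore leaves at most s^4 - 2 s^4 + s^4 = 0.\<close>

lemma opnorm_attained_eigenvector:
  fixes A :: "real^'n^'m"
  assumes "norm v = 1" "norm (A *v v) = opnorm A"
  shows "transpose A *v (A *v v) = (opnorm A)\<^sup>2 *\<^sub>R v"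
proof -
  let ?s = "opnorm A" and ?w = "transpose A *v (A *v v)"
  have "norm ?w \<le> ?s\<^sup>2"
    using norm_transpose_vector_le[of A "A *v v"] assms by (simp add: power2_eq_square)
  then have "(norm ?w)\<^sup>2 \<le> (?s\<^sup>2)\<^sup>2"
    by (rule power_mono) simp
  moreover have "?w \<bullet> v = ?s\<^sup>2"
    using assms by (simp add: inner_transpose dot_square_norm)
  moreover have "(norm (?w - ?s\<^sup>2 *\<^sub>R v))\<^sup>2 = (norm ?w)\<^sup>2 - 2 * ?s\<^sup>2 * (?w \<bullet> v) + (?s\<^sup>2)\<^sup>2 * (norm v)\<^sup>2"
    unfolding power2_norm_eq_inner
    by (simp add: inner_diff_left inner_diff_right inner_commute algebra_simps power2_eq_square)
  ultimately have "(norm (?w - ?s\<^sup>2 *\<^sub>R v))\<^sup>2 \<le> 0"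
    using assms by (simp add: power2_eq_square)
  then show ?thesis
    by simp
qed

section \<open>Singular values and the spectral norm\<close>

lemma singular_valueE:
  assumes "s \<in> singular_values A"
  obtains v where "s \<ge> 0" "v \<noteq> 0" "transpose A *v (A *v v) = s\<^sup>2 *\<^sub>R v"
  using assms by (auto simp: singular_values_def matrix_vector_mul_assoc)

text \<open>Pairing the eigenvector equation with v gives |A v| = s |v|.\<close>

lemma singular_value_le_opnorm:
  assumes "s \<in> singular_values A"
  shows "s \<le> opnorm A"
proof -
  from assms obtain v where s: "s \<ge> 0" and v: "v \<noteq> 0"
    and eq: "transpose A *v (A *v v) = s\<^sup>2 *\<^sub>R v"
    by (rule singular_valueE)
  have "(norm (A *v v))\<^sup>2 = (s * norm v)\<^sup>2"
    using inner_transpose[of A "A *v v" v]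
    by (simp add: eq dot_square_norm power_mult_distrib)
  then have "norm (A *v v) = s * norm v"
    using s by (simp add: power2_eq_iff_nonneg)
  then show ?thesis
    using norm_matrix_vector_le[of A v] v by simp
qed

lemma opnorm_singular_value: "opnorm A \<in> singular_values A"
proof -
  obtain v where v: "norm v = 1" "norm (A *v v) = opnorm A"
    by (rule opnorm_attained)
  from v(1) have "v \<noteq> 0"
    by auto
  with opnorm_attained_eigenvector[OF v] show ?thesis
    by (auto simp: singular_values_def matrix_vector_mul_assoc[symmetric] opnorm_nonneg)
qed

text \<open>\<open>Max\<close> is meaningful only on a finite set. Eigenvectors of the symmetric
  matrix A^T A for distinct eigenvalues are orthogonal, and a pairwise orthogonal set is
  finite.\<close>

lemma finite_singular_values: "finite (singular_values A)"
proof -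
  have "\<forall>s\<in>singular_values A. \<exists>v. v \<noteq> 0 \<and> transpose A *v (A *v v) = s\<^sup>2 *\<^sub>R v"
    by (blast elim: singular_valueE)
  then obtain f where f: "\<And>s. s \<in> singular_values A \<Longrightarrow> f s \<noteq> 0"
    "\<And>s. s \<in> singular_values A \<Longrightarrow> transpose A *v (A *v f s) = s\<^sup>2 *\<^sub>R f s"
    by metis
  have orth: "f s \<bullet> f t = 0"
    if "s \<in> singular_values A" "t \<in> singular_values A" "s \<noteq> t" for s t
  proof -
    have "s\<^sup>2 * (f s \<bullet> f t) = t\<^sup>2 * (f s \<bullet> f t)"
      using f(2) that inner_transpose[of A "A *v f s" "f t"] inner_transpose[of A "A *v f t" "f s"]
      by (simp add: inner_commute)
    \<comment> \<open>Squaring is injective here because singular values are nonnegative.\<close>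
    moreover have "s\<^sup>2 \<noteq> t\<^sup>2"
      using that by (auto elim!: singular_valueE simp: power2_eq_iff_nonneg)
    ultimately show ?thesis
      by simp
  qed
  \<comment> \<open>A vector chosen for two distinct singular values would be orthogonal to itself,
    hence zero.\<close>
  have inj: "inj_on f (singular_values A)"
    by (rule inj_onI) (metis orth f(1) inner_eq_zero_iff)
  have "pairwise orthogonal (f ` singular_values A)"
    by (auto simp: pairwise_def orthogonal_def dest: orth)
  then have "finite (f ` singular_values A)"
    by (rule pairwise_orthogonal_imp_finite)
  then show ?thesis
    using inj by (rule finite_imageD)
qed

lemma spectral_norm_eq_opnorm: "spectral_norm A = opnorm A"
  unfolding spectral_norm_def
  by (rule Max_eqI) (auto intro: finite_singular_values singular_value_le_opnorm opnorm_singular_value)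

lemma spectral_norm_scaleR: "spectral_norm (c *\<^sub>R A) = \<bar>c\<bar> * spectral_norm A"
proof -
  have "(*v) (c *\<^sub>R A) = (\<lambda>x. c *\<^sub>R (A *v x))"
    by (simp add: fun_eq_iff scaleR_matrix_vector_assoc)
  then show ?thesis
    by (simp add: spectral_norm_eq_opnorm onorm_scaleR matrix_vector_mul_bounded_linear)
qed

section \<open>The maximal entry and its comparison with the spectral norm\<close>

lemma finite_abs_entries: "finite {\<bar>A $ i $ j\<bar> | i j. True}" for A :: "real^'n^'m"
proof -
  have "{\<bar>A $ i $ j\<bar> | i j. True} = range (\<lambda>(i, j). \<bar>A $ i $ j\<bar>)"
    by auto
  then show ?thesis
    by simp
qed

lemma abs_entry_le_max_entry_norm: "\<bar>A $ i $ j\<bar> \<le> max_entry_norm A"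
  unfolding max_entry_norm_def by (rule Max_ge) (use finite_abs_entries[of A] in auto)

lemma max_entry_norm_attained:
  obtains i j where "max_entry_norm A = \<bar>A $ i $ j\<bar>"
proof -
  have "max_entry_norm A \<in> {\<bar>A $ i $ j\<bar> | i j. True}"
    unfolding max_entry_norm_def by (rule Max_in) (use finite_abs_entries[of A] in auto)
  then show thesis
    using that by auto
qed

lemma max_entry_norm_scaleR: "max_entry_norm (c *\<^sub>R A) = \<bar>c\<bar> * max_entry_norm A"
proof (rule antisym)
  obtain i j where "max_entry_norm (c *\<^sub>R A) = \<bar>(c *\<^sub>R A) $ i $ j\<bar>"
    by (rule max_entry_norm_attained)
  then show "max_entry_norm (c *\<^sub>R A) \<le> \<bar>c\<bar> * max_entry_norm A"
    by (simp add: abs_mult mult_left_mono abs_entry_le_max_entry_norm)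
  obtain i j where "max_entry_norm A = \<bar>A $ i $ j\<bar>"
    by (rule max_entry_norm_attained)
  then show "\<bar>c\<bar> * max_entry_norm A \<le> max_entry_norm (c *\<^sub>R A)"
    using abs_entry_le_max_entry_norm[of "c *\<^sub>R A" i j] by (simp add: abs_mult)
qed

lemma max_entry_norm_pos:
  assumes "A \<noteq> 0"
  shows "0 < max_entry_norm A"
proof -
  from assms obtain i j where "A $ i $ j \<noteq> 0"
    by (auto simp: vec_eq_iff)
  then show ?thesis
    using abs_entry_le_max_entry_norm[of A i j] by linarith
qed

text \<open>Each entry is a coordinate of the image of a standard unit vector.\<close>

lemma max_entry_norm_le_spectral_norm: "max_entry_norm A \<le> spectral_norm A"
proof -
  obtain i j where ij: "max_entry_norm A = \<bar>A $ i $ j\<bar>"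
    by (rule max_entry_norm_attained)
  have "\<bar>A $ i $ j\<bar> = \<bar>(A *v axis j 1) $ i\<bar>"
    by (simp add: matrix_vector_mult_basis column_def)
  also have "\<dots> \<le> norm (A *v axis j 1)"
    by (rule component_le_norm_cart)
  also have "\<dots> \<le> opnorm A"
    using norm_matrix_vector_le[of A "axis j 1"] by (simp add: norm_axis_1)
  finally show ?thesis
    by (simp add: ij spectral_norm_eq_opnorm)
qed

text \<open>The constant is crude; it serves only to show that the supremum in \<open>mu\<close> is
  over a bounded set.\<close>

lemma spectral_norm_le_max_entry_norm:
  "spectral_norm A \<le> real CARD('n) * real CARD('n) * max_entry_norm A" for A :: "real^'n^'n"
  unfolding spectral_norm_eq_opnorm
  by (rule onorm_le_matrix_component) (rule abs_entry_le_max_entry_norm)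

section \<open>The suprema as upper bounds, and scaling in the two spaces\<close>

lemma max_entry_norm_le_xi:
  assumes "N \<in> tangent_space B" "spectral_norm N \<le> 1"
  shows "max_entry_norm N \<le> xi B"
  unfolding xi_def
proof (rule cSUP_upper)
  show "bdd_above (max_entry_norm ` {N \<in> tangent_space B. spectral_norm N \<le> 1})"
    by (rule bdd_aboveI2[of _ _ 1]) (auto intro: order_trans[OF max_entry_norm_le_spectral_norm])
qed (use assms in simp)

lemma spectral_norm_le_mu:
  fixes A N :: "real^'n^'n"
  assumes "N \<in> support_space A" "max_entry_norm N \<le> 1"
  shows "spectral_norm N \<le> mu A"
  unfolding mu_def
proof (rule cSUP_upper)
  have "spectral_norm N \<le> real CARD('n) * real CARD('n)"
    if "max_entry_norm N \<le> 1" for N :: "real^'n^'n"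
    using spectral_norm_le_max_entry_norm[of N]
      mult_left_mono[OF that, of "real CARD('n) * real CARD('n)"]
    unfolding mult_1_right by (meson order_trans mult_nonneg_nonneg of_nat_0_le_iff)
  then show "bdd_above (spectral_norm ` {N \<in> support_space A. max_entry_norm N \<le> 1})"
    by (intro bdd_aboveI2) auto
qed (use assms in simp)

lemma support_space_scaleR: "N \<in> support_space A \<Longrightarrow> c *\<^sub>R N \<in> support_space A"
  by (auto simp: support_space_def matrix_support_def)

lemma mult_transpose_scaleR_right:
  "mult_transpose k U (\<lambda>l. c *\<^sub>R X l) = c *\<^sub>R mult_transpose k U X"
  by (simp add: mult_transpose_def vec_eq_iff sum_distrib_left mult_ac)

lemma mult_transpose_scaleR_left:
  "mult_transpose k (\<lambda>l. c *\<^sub>R Y l) V = c *\<^sub>R mult_transpose k Y V"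
  by (simp add: mult_transpose_def vec_eq_iff sum_distrib_left mult_ac)

text \<open>The decomposition of \<open>B\<close> is kept and the scalar is absorbed into
  \<open>X\<close> and \<open>Y\<close>.\<close>

lemma tangent_space_scaleR:
  assumes "N \<in> tangent_space B"
  shows "c *\<^sub>R N \<in> tangent_space B"
proof -
  from assms obtain U \<sigma> V X Y where svd: "compact_svd B U \<sigma> V"
    and N: "N = mult_transpose (rank B) U X + mult_transpose (rank B) Y V"
    unfolding tangent_space_def by blast
  have "c *\<^sub>R N = mult_transpose (rank B) U (\<lambda>l. c *\<^sub>R X l) + mult_transpose (rank B) (\<lambda>l. c *\<^sub>R Y l) V"
    by (simp add: N mult_transpose_scaleR_right mult_transpose_scaleR_left scaleR_add_right)
  with svd show ?thesis
    unfolding tangent_space_def by blast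
qed

section \<open>Existence of a compact singular value decomposition\<close>

lemma mult_transpose_vector:
  "mult_transpose k U V *v x = (\<Sum>l<k. (V l \<bullet> x) *\<^sub>R U l)"
proof -
  have "(mult_transpose k U V *v x) $ i = (\<Sum>l<k. (V l \<bullet> x) *\<^sub>R U l) $ i" for i
    by (simp add: mult_transpose_def matrix_vector_mult_def inner_vec_def sum_distrib_right
        sum_distrib_left, subst sum.swap, simp add: mult_ac)
  then show ?thesis
    by (simp add: vec_eq_iff)
qed

lemma mult_transpose_cong:
  assumes "\<And>l. l < k \<Longrightarrow> U l = U' l" "\<And>l. l < k \<Longrightarrow> V l = V' l"
  shows "mult_transpose k U V = mult_transpose k U' V'"
  using assms unfolding mult_transpose_def vec_eq_iff by simp

lemma mult_transpose_Suc:
  "mult_transpose (Suc k) U V = mult_transpose k U V + mult_transpose 1 (\<lambda>_. U k) (\<lambda>_. V k)"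
  by (simp add: mult_transpose_def vec_eq_iff)

text \<open>Orthonormality of \<open>V\<close> leaves a single summand. The length \<open>k\<close>
  is arbitrary, so that this applies before \<open>k\<close> is known to be the rank.\<close>

lemma svd_vector:
  assumes "orthonormal_columns k V" "M = mult_transpose k (\<lambda>l. \<sigma> l *\<^sub>R U l) V" "l < k"
  shows "M *v V l = \<sigma> l *\<^sub>R U l"
proof -
  have "M *v V l = (\<Sum>m<k. if m = l then \<sigma> l *\<^sub>R U l else 0)"
    unfolding assms(2) mult_transpose_vector
    using assms(1,3) by (intro sum.cong) (auto simp: orthonormal_columns_def)
  then show ?thesis
    using assms(3) by simp
qed

lemma svd_vector_transpose:
  assumes "orthonormal_columns k U" "M = mult_transpose k (\<lambda>l. \<sigma> l *\<^sub>R U l) V" "l < k"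
  shows "transpose M *v U l = \<sigma> l *\<^sub>R V l"
proof (rule svd_vector[OF assms(1) _ assms(3)])
  show "transpose M = mult_transpose k (\<lambda>l. \<sigma> l *\<^sub>R V l) U"
    unfolding assms(2) by (simp add: mult_transpose_def transpose_def vec_eq_iff mult_ac)
qed

lemma orthonormal_columns_extend:
  assumes "orthonormal_columns k U" "norm u = 1" "\<And>l. l < k \<Longrightarrow> u \<bullet> U l = 0"
  shows "orthonormal_columns (Suc k) (U(k := u))"
  using assms
  by (auto simp: orthonormal_columns_def less_Suc_eq inner_commute dot_square_norm)

text \<open>Induction on the dimension of the range: one singular triple for the largest singular
  value is split off, and the remainder has a smaller range. The length stays existential here;
  \<open>rank_svd\<close> identifies it with the rank.\<close>

lemma svd_exists_some_length:
  fixes M :: "real^'n^'n"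
  shows "\<exists>k U \<sigma> V. orthonormal_columns k U \<and> orthonormal_columns k V \<and> (\<forall>l<k. \<sigma> l > 0) \<and>
    M = mult_transpose k (\<lambda>l. \<sigma> l *\<^sub>R U l) V"
proof (induction "dim (range ((*v) M))" arbitrary: M rule: less_induct)
  case less
  show ?case
  proof (cases "M = 0")
    case True
    then show ?thesis
      by (intro exI[of _ 0]) (simp add: orthonormal_columns_def mult_transpose_def vec_eq_iff)
  next
    case False
    define s where "s = opnorm M"
    obtain v where v: "norm v = 1" "norm (M *v v) = s"
      unfolding s_def by (rule opnorm_attained)
    have "s > 0"
      using max_entry_norm_pos[OF False] max_entry_norm_le_spectral_norm[of M]
      by (simp add: s_def spectral_norm_eq_opnorm)
    define u where "u = (1 / s) *\<^sub>R (M *v v)"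
    have Mv: "M *v v = s *\<^sub>R u"
      using \<open>s > 0\<close> by (simp add: u_def)
    have u: "norm u = 1"
      using \<open>s > 0\<close> v by (simp add: u_def)
    \<comment> \<open>The eigenvector equation M^T M v = s^2 v, divided by s.\<close>
    have Mu: "transpose M *v u = s *\<^sub>R v"
      using opnorm_attained_eigenvector[OF v[unfolded s_def]] \<open>s > 0\<close>
      by (simp add: u_def matrix_vector_mult_scaleR s_def power2_eq_square)
    \<comment> \<open>Subtracting s u v^T puts v into the kernel of \<open>M'\<close> and makes u
      orthogonal to its range.\<close>
    define M' where "M' = M - mult_transpose 1 (\<lambda>_. s *\<^sub>R u) (\<lambda>_. v)"
    have M'_vec: "M' *v x = M *v x - (v \<bullet> x) *\<^sub>R (s *\<^sub>R u)" for x
      by (simp add: M'_def matrix_vector_mult_diff_rdistrib mult_transpose_vector)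
    have M'v: "M' *v v = 0"
      using v by (simp add: M'_vec Mv dot_square_norm)
    have uM': "u \<bullet> (M' *v x) = 0" for x
      using inner_transpose[of M u x] u
      by (simp add: M'_vec inner_diff_right Mu dot_square_norm mult.commute)
    have M'v': "v \<bullet> (transpose M' *v x) = 0" for x
      using inner_transpose[of M' x v] by (simp add: M'v inner_commute)
    have sub: "range ((*v) M') \<subseteq> range ((*v) M)"
    proof (intro image_subsetI)
      fix x
      have "M' *v x = M *v (x - (v \<bullet> x) *\<^sub>R v)"
        by (simp add: M'_vec Mv matrix_vector_mult_diff_distrib matrix_vector_mult_scaleR)
      then show "M' *v x \<in> range ((*v) M)"
        by simp
    qed
    \<comment> \<open>The vector u witnesses that the inclusion of ranges is strict: it lies in the
      range of \<open>M\<close>, but is nonzero and orthogonal to that of \<open>M'\<close>.\<close>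
    have "u \<in> range ((*v) M)"
      unfolding u_def by (simp flip: matrix_vector_mult_scaleR)
    moreover have "u \<notin> range ((*v) M')"
    proof
      assume "u \<in> range ((*v) M')"
      then obtain x where "u = M' *v x"
        by auto
      with uM'[of x] have "u \<bullet> u = 0"
        by simp
      with u show False
        by simp
    qed
    ultimately have psub: "range ((*v) M') \<subset> range ((*v) M)"
      using sub by blast
    \<comment> \<open>\<open>dim_psubset\<close> compares spans, and ranges are already
      subspaces.\<close>
    have span_range: "span (range ((*v) K)) = range ((*v) K)" for K :: "real^'n^'n"
      by (simp add: span_eq_iff subspace_UNIV linear_subspace_image)
    have "dim (range ((*v) M')) < dim (range ((*v) M))"
      by (rule dim_psubset) (unfold span_range, rule psub)
    then obtain k U \<sigma> V where svd: "orthonormal_columns k U" "orthonormal_columns k V"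
      "\<And>l. l < k \<Longrightarrow> \<sigma> l > 0" "M' = mult_transpose k (\<lambda>l. \<sigma> l *\<^sub>R U l) V"
      using less by metis
    \<comment> \<open>Since \<open>\<sigma> l\<close> is positive, \<open>U l\<close> is a multiple
      of \<open>M' *v V l\<close>, so it is orthogonal to u. The argument for \<open>V l\<close>
      below is the same with the transpose.\<close>
    have "u \<bullet> U l = 0" if "l < k" for l
      using uM'[of "V l"] svd(3)[OF that] svd_vector[OF svd(2,4) that] by simp
    then have "orthonormal_columns (Suc k) (U(k := u))"
      by (intro orthonormal_columns_extend svd u)
    moreover have "v \<bullet> V l = 0" if "l < k" for l
      using M'v'[of "U l"] svd(3)[OF that] svd_vector_transpose[OF svd(1,4) that] by simp
    then have "orthonormal_columns (Suc k) (V(k := v))"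
      by (intro orthonormal_columns_extend svd v)
    moreover have "\<forall>l<Suc k. (\<sigma>(k := s)) l > 0"
      using svd(3) \<open>s > 0\<close> by (simp add: less_Suc_eq)
    \<comment> \<open>The sum of length \<open>k\<close> never reads the updated index
      \<open>k\<close>.\<close>
    moreover have "mult_transpose k (\<lambda>l. (\<sigma>(k := s)) l *\<^sub>R (U(k := u)) l) (V(k := v)) = M'"
      unfolding svd(4) by (rule mult_transpose_cong) auto
    then have "M = mult_transpose (Suc k) (\<lambda>l. (\<sigma>(k := s)) l *\<^sub>R (U(k := u)) l) (V(k := v))"
      by (simp add: mult_transpose_Suc[of k] M'_def)
    ultimately show ?thesis
      by blast
  qed
qed

text \<open>The range of \<open>M\<close> is the span of the first \<open>k\<close> columns of
  \<open>U\<close>: positivity of the singular values allows each column to be recovered as an image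
  under \<open>M\<close>. Orthonormality makes these columns distinct and independent.\<close>

lemma rank_svd:
  fixes M :: "real^'n^'n"
  assumes U: "orthonormal_columns k U" and V: "orthonormal_columns k V"
    and pos: "\<And>l. l < k \<Longrightarrow> \<sigma> l > 0" and M: "M = mult_transpose k (\<lambda>l. \<sigma> l *\<^sub>R U l) V"
  shows "rank M = k"
proof -
  have "M *v x \<in> span (U ` {..<k})" for x
    unfolding M mult_transpose_vector
    by (intro span_sum span_scale span_base) auto
  moreover have "U l \<in> range ((*v) M)" if "l < k" for l
  proof -
    have "U l = M *v ((1 / \<sigma> l) *\<^sub>R V l)"
      using pos[OF that] by (simp add: matrix_vector_mult_scaleR svd_vector[OF V M that])
    then show ?thesis
      by simp
  qed
  then have "U ` {..<k} \<subseteq> range ((*v) M)"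
    by auto
  then have "span (U ` {..<k}) \<subseteq> range ((*v) M)"
    by (rule span_minimal) (simp add: subspace_UNIV linear_subspace_image)
  ultimately have range: "range ((*v) M) = span (U ` {..<k})"
    by auto
  have inj: "inj_on U {..<k}"
    using U by (intro inj_onI) (metis lessThan_iff orthonormal_columns_def zero_neq_one)
  have "pairwise orthogonal (U ` {..<k})"
    using U by (auto simp: pairwise_def orthogonal_def orthonormal_columns_def)
  moreover have "0 \<notin> U ` {..<k}"
    using U by (force simp: orthonormal_columns_def)
  ultimately have "independent (U ` {..<k})"
    by (rule pairwise_orthogonal_independent)
  then have "dim (range ((*v) M)) = card (U ` {..<k})"
    by (simp add: range dim_eq_card_independent)
  also have "\<dots> = k"
    using inj by (simp add: card_image)
  finally show ?thesis
    by (simp add: rank_dim_range)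
qed

lemma compact_svd_exists: "\<exists>U \<sigma> V. compact_svd M U \<sigma> V"
  using svd_exists_some_length[of M] rank_svd unfolding compact_svd_def by metis

text \<open>\<open>tangent_space\<close> collects matrices over all compact decompositions, so it is
  nonempty only because one exists; then X = Y = 0 works.\<close>

lemma zero_in_tangent_space: "0 \<in> tangent_space B"
proof -
  obtain U \<sigma> V where "compact_svd B U \<sigma> V"
    using compact_svd_exists by blast
  then have "mult_transpose (rank B) U (\<lambda>_. 0) + mult_transpose (rank B) (\<lambda>_. 0) V \<in> tangent_space B"
    unfolding tangent_space_def by blast
  moreover have "mult_transpose (rank B) U (\<lambda>_. 0) + mult_transpose (rank B) (\<lambda>_. 0) V = 0"
    by (simp add: mult_transpose_def vec_eq_iff)
  ultimately show ?thesis
    by simp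
qed

theorem proposition1:
  fixes A B :: "real^'n^'n"
  assumes "mu A * xi B < 1"
  shows "support_space A \<inter> tangent_space B = {0}"
proof -
  have "N = 0" if N: "N \<in> support_space A" "N \<in> tangent_space B" for N
  proof (rule ccontr)
    assume "N \<noteq> 0"
    define c s where "c = max_entry_norm N" and "s = spectral_norm N"
    have "c > 0"
      unfolding c_def using \<open>N \<noteq> 0\<close> by (rule max_entry_norm_pos)
    then have "s > 0"
      using max_entry_norm_le_spectral_norm[of N] by (simp add: c_def s_def)
    have "max_entry_norm ((1 / s) *\<^sub>R N) \<le> xi B"
      using \<open>s > 0\<close> N
      by (intro max_entry_norm_le_xi tangent_space_scaleR) (simp_all add: spectral_norm_scaleR flip: s_def)
    then have xi: "c / s \<le> xi B"
      using \<open>s > 0\<close> by (simp add: max_entry_norm_scaleR flip: c_def)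
    have "spectral_norm ((1 / c) *\<^sub>R N) \<le> mu A"
      using \<open>c > 0\<close> N
      by (intro spectral_norm_le_mu support_space_scaleR) (simp_all add: max_entry_norm_scaleR flip: c_def)
    then have mu: "s / c \<le> mu A"
      using \<open>c > 0\<close> by (simp add: spectral_norm_scaleR flip: s_def)
    \<comment> \<open>The left side equals 1. Multiplying the two bounds requires
      \<open>mu A\<close> to be nonnegative, which follows from 0 <= s / c.\<close>
    have "(s / c) * (c / s) \<le> mu A * xi B"
      using \<open>c > 0\<close> \<open>s > 0\<close> by (intro mult_mono mu xi order_trans[OF _ mu]) simp_all
    then show False
      using assms \<open>c > 0\<close> \<open>s > 0\<close> by simp
  qed
  moreover have "0 \<in> support_space A"
    by (simp add: support_space_def matrix_support_def)
  ultimately show ?thesis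
    using zero_in_tangent_space by blast
qed

end
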